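(* Let $\{\boldsymbol{x}^k\}_{k\ge 0}$ be the (infinite) sequence generated by the Basic Gauss-Newton Algorithm described in the context, with fixed penalty parameter $\beta>0$ and $L_{\min}\in(0,\beta L_\Psi]$. Then $\{\boldsymbol{x}^k\}\subset\mathcal{L}_F(F(\boldsymbol{x}^0))$ and, for every integer $K\ge 0$, $$\min_{0\le k\le K}\Vert \boldsymbol{G}_{\beta L_\Psi}(\boldsymbol{x}^k)\Vert^2\le \frac{2(\beta L_\Psi)^2}{L_{\min}(K+1)}\left[F(\boldsymbol{x}^0)-F^\star\right],$$ where $F^\star:=\inf_{\boldsymbol{x}\in\Omega}F(\boldsymbol{x})>-\infty$. Moreover, $$\lim_{k\to\infty}\Vert\boldsymbol{x}^{k+1}-\boldsymbol{x}^k\Vert=0\quad\text{and}\quad \lim_{k\to\infty}\Vert\boldsymbol{G}_{\beta L_\Psi}(\boldsymbol{x}^k)\Vert=0,$$ and the set $\hat{\mathcal{S}}^*$ of limit points of $\{\boldsymbol{x}^k\}_{k\ge0}$ is connected. If the sequence $\{\boldsymbol{x}^k\}$ is bounded (in particular, if $\mathcal{L}_F(F(\boldsymbol{x}^0))$ is bounded), then every limit point is a stationary point of the penalized problem (P). Moreover, if $\hat{\mathcal{S}}^*$ is finite, then $\{\boldsymbol{x}^k\}$ converges to a stationary point $\boldsymbol{x}^*$ of (P). If, in addition, $\boldsymbol{x}^*$ is feasible for the constrained problem (C) and $\beta$ is sufficiently large (i.e. $\beta\ge\bar\beta$ for some threshold $\bar\beta$ depending only on $f,\Psi,\Omega$),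 then $\boldsymbol{x}^*$ is also a stationary point of (C).
   Context: Setting. $\Omega\subset\mathbb{R}^d$ is a nonempty compact convex set, $f:\mathbb{R}^d\to\mathbb{R}$ is convex and differentiable, and $\Psi:\mathbb{R}^d\to\mathbb{R}^n$ is differentiable with Jacobian $\Psi'(\boldsymbol{x})\in\mathbb{R}^{n\times d}$ that is Lipschitz continuous on $\Omega$: there is $L_\Psi>0$ with $\Vert\Psi'(\boldsymbol{x})-\Psi'(\hat{\boldsymbol{x}})\Vert\le L_\Psi\Vert\boldsymbol{x}-\hat{\boldsymbol{x}}\Vert$ for all $\boldsymbol{x},\hat{\boldsymbol{x}}\in\Omega$. Here $\Vert\cdot\Vert$ is the $\ell_2$-norm (induced norm for matrices) and $|\cdot|$ is the $\ell_1$-norm. Constrained problem (C): $\min_{\boldsymbol{x}\in\mathbb{R}^d} f(\boldsymbol{x})$ subject to $\Psi(\boldsymbol{x})=0$, $\boldsymbol{x}\in\Omega$. Penalized problem (P), with penalty parameter $\beta>0$: $\min_{\boldsymbol{x}\in\Omega}\{F(\boldsymbol{x}):=f(\boldsymbol{x})+\beta|\Psi(\boldsymbol{x})|\}$. Normal cone: $\mathcal{N}_\Omega(\boldsymbol{x})=\{\boldsymbol{w}\in\mathbb{R}^d: \boldsymbol{w}^\top(\boldsymbol{y}-\boldsymbol{x})\le 0\ \ \forall\boldsymbol{y}\in\Omega\}$ for $\boldsymbol{x}\in\Omega$, and $\emptyset$ otherwise. A point $\boldsymbol{x}^*$ is a stationary point of (C) if $\boldsymbol{x}^*\in\Omega$,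 $\Psi(\boldsymbol{x}^* )=0$, and there is $\boldsymbol{y}^*\in\mathbb{R}^n$ with $-\nabla f(\boldsymbol{x}^* )-\Psi'(\boldsymbol{x}^* )^\top\boldsymbol{y}^*\in\mathcal{N}_\Omega(\boldsymbol{x}^* )$. A point $\boldsymbol{x}^*\in\Omega$ is a stationary point of (P) if $0\in\nabla f(\boldsymbol{x}^* )+\beta\Psi'(\boldsymbol{x}^* )^\top\partial|\cdot|(\Psi(\boldsymbol{x}^* ))+\mathcal{N}_\Omega(\boldsymbol{x}^* )$, where $\partial|\cdot|(\boldsymbol{u})$ is the convex subdifferential of the $\ell_1$-norm at $\boldsymbol{u}$. Feasible for (C) means $\boldsymbol{x}^*\in\Omega$ and $\Psi(\boldsymbol{x}^* )=0$. For $L>0$ and $\boldsymbol{x}^k\in\Omega$ define the model $$\mathcal{Q}_L(\boldsymbol{x};\boldsymbol{x}^k):=f(\boldsymbol{x})+\beta|\Psi(\boldsymbol{x}^k)+\Psi'(\boldsymbol{x}^k)(\boldsymbol{x}-\boldsymbol{x}^k)|+\tfrac{L}{2}\Vert\boldsymbol{x}-\boldsymbol{x}^k\Vert^2,$$ its unique minimizer $\boldsymbol{V}_L(\boldsymbol{x}^k):=\arg\min_{\boldsymbol{x}\in\Omega}\mathcal{Q}_L(\boldsymbol{x};\boldsymbol{x}^k)$, and $\boldsymbol{G}_L(\boldsymbol{x}^k):=L(\boldsymbol{x}^k-\boldsymbol{V}_L(\boldsymbol{x}^k))$. The level set of $F$ is $\mathcal{L}_F(\alpha):=\{\boldsymbol{x}\in\Omega: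 F(\boldsymbol{x})\le\alpha\}$. Basic Gauss-Newton Algorithm (with $\beta$ fixed over all iterations and no cap on the number of iterations): choose $\boldsymbol{x}^0\in\Omega$, $\beta>0$, and $L_{\min}\in(0,\beta L_\Psi]$. For $k=0,1,2,\dots$: find $L_k\in[L_{\min},\beta L_\Psi]$ such that $F(\boldsymbol{V}_{L_k}(\boldsymbol{x}^k))\le\mathcal{Q}_{L_k}(\boldsymbol{V}_{L_k}(\boldsymbol{x}^k);\boldsymbol{x}^k)$, and set $\boldsymbol{x}^{k+1}:=\boldsymbol{V}_{L_k}(\boldsymbol{x}^k)$. *)

theory Defs
  imports "HOL-Analysis.Analysis"
begin

definition gradient :: "(real^'d \<Rightarrow> real) \<Rightarrow> real^'d \<Rightarrow> real^'d" where
  "gradient f x = (THE D. GDERIV f x :> D)"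

definition l1_norm :: "real^'n \<Rightarrow> real" where
  "l1_norm u = (\<Sum>i\<in>UNIV. \<bar>u $ i\<bar>)"

definition subdifferential :: "(real^'n \<Rightarrow> real) \<Rightarrow> real^'n \<Rightarrow> (real^'n) set" where
  "subdifferential g u = {s. \<forall>v. g v \<ge> g u + s \<bullet> (v - u)}"

definition normal_cone :: "(real^'d) set \<Rightarrow> real^'d \<Rightarrow> (real^'d) set" where
  "normal_cone \<Omega> x = (if x \<in> \<Omega> then {w. \<forall>y\<in>\<Omega>. w \<bullet> (y - x) \<le> 0} else {})"

(* The library norm on real^'d^'n is the Frobenius norm; the induced l2 operator norm of a
   matrix is the onorm of the linear map it represents. *)
definition jacobian_lipschitz_on ::
    "real \<Rightarrow> (real^'d) set \<Rightarrow> (real^'d \<Rightarrow> real^'n) \<Rightarrow> bool" where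
  "jacobian_lipschitz_on L \<Omega> \<Psi> \<longleftrightarrow>
     0 < L \<and>
     (\<forall>x\<in>\<Omega>. \<forall>x'\<in>\<Omega>.
        onorm ((*v) (jacobian \<Psi> (at x) - jacobian \<Psi> (at x'))) \<le> L * norm (x - x'))"

definition feasible_C :: "(real^'d \<Rightarrow> real^'n) \<Rightarrow> (real^'d) set \<Rightarrow> real^'d \<Rightarrow> bool" where
  "feasible_C \<Psi> \<Omega> x \<longleftrightarrow> x \<in> \<Omega> \<and> \<Psi> x = 0"

definition stationary_C ::
    "(real^'d \<Rightarrow> real) \<Rightarrow> (real^'d \<Rightarrow> real^'n) \<Rightarrow> (real^'d) set \<Rightarrow> real^'d \<Rightarrow> bool" where
  "stationary_C f \<Psi> \<Omega> x \<longleftrightarrow>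
     x \<in> \<Omega> \<and> \<Psi> x = 0 \<and>
     (\<exists>y. - gradient f x - transpose (jacobian \<Psi> (at x)) *v y \<in> normal_cone \<Omega> x)"

definition penalized ::
    "(real^'d \<Rightarrow> real) \<Rightarrow> (real^'d \<Rightarrow> real^'n) \<Rightarrow> real \<Rightarrow> real^'d \<Rightarrow> real" where
  "penalized f \<Psi> \<beta> x = f x + \<beta> * l1_norm (\<Psi> x)"

definition stationary_P ::
    "(real^'d \<Rightarrow> real) \<Rightarrow> (real^'d \<Rightarrow> real^'n) \<Rightarrow> (real^'d) set \<Rightarrow> real \<Rightarrow> real^'d \<Rightarrow> bool" where
  "stationary_P f \<Psi> \<Omega> \<beta> x \<longleftrightarrow>
     x \<in> \<Omega> \<and>
     0 \<in> {gradient f x + \<beta> *\<^sub>R (transpose (jacobian \<Psi> (at x)) *v s) + w | s w.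
            s \<in> subdifferential l1_norm (\<Psi> x) \<and> w \<in> normal_cone \<Omega> x}"

definition level_set ::
    "(real^'d \<Rightarrow> real) \<Rightarrow> (real^'d) set \<Rightarrow> real \<Rightarrow> (real^'d) set" where
  "level_set F \<Omega> \<alpha> = {x \<in> \<Omega>. F x \<le> \<alpha>}"

definition gn_model ::
    "(real^'d \<Rightarrow> real) \<Rightarrow> (real^'d \<Rightarrow> real^'n) \<Rightarrow> real \<Rightarrow> real \<Rightarrow> real^'d \<Rightarrow> real^'d \<Rightarrow> real" where
  "gn_model f \<Psi> \<beta> L xk x =
     f x + \<beta> * l1_norm (\<Psi> xk + jacobian \<Psi> (at xk) *v (x - xk)) + L / 2 * (norm (x - xk))\<^sup>2"

(* For compact, convex, nonempty \<Omega>, convex f and L > 0 the model is continuous and strongly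
   convex, so the minimizer chosen here exists and is unique. *)
definition gn_step ::
    "(real^'d \<Rightarrow> real) \<Rightarrow> (real^'d \<Rightarrow> real^'n) \<Rightarrow> (real^'d) set \<Rightarrow> real \<Rightarrow> real \<Rightarrow> real^'d \<Rightarrow> real^'d" where
  "gn_step f \<Psi> \<Omega> \<beta> L xk = arg_min_on (gn_model f \<Psi> \<beta> L xk) \<Omega>"

definition gn_gradient_map ::
    "(real^'d \<Rightarrow> real) \<Rightarrow> (real^'d \<Rightarrow> real^'n) \<Rightarrow> (real^'d) set \<Rightarrow> real \<Rightarrow> real \<Rightarrow> real^'d \<Rightarrow> real^'d" where
  "gn_gradient_map f \<Psi> \<Omega> \<beta> L xk = L *\<^sub>R (xk - gn_step f \<Psi> \<Omega> \<beta> L xk)"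

(* The algorithm is nondeterministic in the choice of the step parameters, which are therefore
   recorded as a sequence L next to the iterates x; M is the Lipschitz constant of the Jacobian. *)
definition basic_gauss_newton ::
    "(real^'d \<Rightarrow> real) \<Rightarrow> (real^'d \<Rightarrow> real^'n) \<Rightarrow> (real^'d) set \<Rightarrow> real \<Rightarrow> real \<Rightarrow> real
      \<Rightarrow> (nat \<Rightarrow> real) \<Rightarrow> (nat \<Rightarrow> real^'d) \<Rightarrow> bool" where
  "basic_gauss_newton f \<Psi> \<Omega> M \<beta> Lmin L x \<longleftrightarrow>
     x 0 \<in> \<Omega> \<and> 0 < \<beta> \<and> Lmin \<in> {0<..\<beta> * M} \<and>
     (\<forall>k. L k \<in> {Lmin..\<beta> * M} \<and>
          penalized f \<Psi> \<beta> (gn_step f \<Psi> \<Omega> \<beta> (L k) (x k))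
            \<le> gn_model f \<Psi> \<beta> (L k) (x k) (gn_step f \<Psi> \<Omega> \<beta> (L k) (x k)) \<and>
          x (Suc k) = gn_step f \<Psi> \<Omega> \<beta> (L k) (x k))"

(* Limit points of a sequence are its subsequential limits, not the accumulation points of its
   range: they include the value of an eventually constant sequence. *)
definition limit_points :: "(nat \<Rightarrow> real^'d) \<Rightarrow> (real^'d) set" where
  "limit_points x = {p. \<exists>r. strict_mono r \<and> (x \<circ> r) \<longlonglongrightarrow> p}"

end

theory Submission
  imports Defs
begin

text \<open>
  The argument rests on descent, on connectedness of limit sets of slowly moving sequences, and on
  one application of the separating hyperplane theorem.

  The model \<open>Q\<^sub>L(\<cdot>; c)\<close> is a convex function plus \<open>L/2\<close> times the squared distance to \<open>c\<close>, so it grows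
  quadratically away from its minimizer (\<open>quadratic_growth_at_prox_minimizer\<close>).  Its value at \<open>c\<close> is
  \<open>F(c)\<close>, hence the acceptance test of the algorithm gives
  \<open>L\<^sub>k/2 \<parallel>x\<^sup>k\<^sup>+\<^sup>1 - x\<^sup>k\<parallel>\<^sup>2 \<le> F(x\<^sup>k) - F(x\<^sup>k\<^sup>+\<^sup>1)\<close>, and telescoping bounds the sum of the squared
  steps by the gap between \<open>F(x\<^sup>0)\<close> and the infimum.  A larger penalty \<open>L\<close> on the distance gives a
  shorter step (\<open>step_length_antimono\<close>), so the gradient mapping at \<open>\<beta> L\<^sub>\<Psi>\<close> is at most \<open>\<beta> L\<^sub>\<Psi>\<close>
  times the step actually taken; this transfers both the rate and the limit from the steps to it.

  A sequence in a compact set whose steps vanish cannot pass for ever back and forth between two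
  disjoint closed parts of its limit set without leaving a limit point in the gap, so its
  limit points form a connected set (\<open>connected_limit_points\<close>); if there are finitely many, there is one, and the sequence converges to it.

  At a limit point \<open>p\<close>, passing to the limit in the minimality of \<open>x\<^sup>k\<^sup>+\<^sup>1\<close> for its model shows that
  \<open>p\<close> minimizes its own model at \<open>\<beta> L\<^sub>\<Psi>\<close>; the Lipschitz bound enters as continuity of the Jacobian,
  and the bound \<open>L\<^sub>k \<le> \<beta> L\<^sub>\<Psi>\<close> removes the varying step parameters.  That minimality says that one
  convex function of \<open>z\<close> lies above the negative of another convex function of \<open>\<Psi>'(p) z\<close>, and
  \<open>convex_sandwich_linear\<close> places an affine function between them.  Up to sign, its slope is \<open>\<beta>\<close> times a
  subgradient of the l1-norm at \<open>\<Psi>(p)\<close>, and what remains is a differentiable function minimized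
  over \<open>\<Omega>\<close> at \<open>p\<close>, whose first-order condition is stationarity for the penalized problem.

  If \<open>s\<close> is the subgradient in that condition and \<open>\<Psi>(p) = 0\<close>, then \<open>\<beta> s\<close> is a multiplier for the
  constrained problem, so 0 can serve as the threshold for \<open>\<beta>\<close>.
\<close>

section \<open>Convex duality\<close>

text \<open>
  Separating the set above the graph of \<open>\<phi>\<close>, transported by \<open>A\<close>, from the set strictly below the
  graph of \<open>- g\<close> yields an affine minorant of \<open>g\<close>.  This is Fenchel duality; the dual optimum is
  attained because \<open>g\<close> is finite everywhere, which rules out a vertical hyperplane.
\<close>

lemma convex_sandwich_linear:
  fixes \<phi> :: "'a::real_vector \<Rightarrow> real" and g :: "'b::euclidean_space \<Rightarrow> real"
  assumes "C \<noteq> {}" and \<phi>: "convex_on C \<phi>" and g: "convex_on UNIV g" and A: "linear A"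
    and nonneg: "\<And>z. z \<in> C \<Longrightarrow> 0 \<le> \<phi> z + g (A z)"
  obtains s c where "\<And>v. s \<bullet> v + c \<le> g v" and "\<And>z. z \<in> C \<Longrightarrow> 0 \<le> \<phi> z + s \<bullet> A z + c"
proof -
  define S where "S = {(v, r). \<exists>z\<in>C. v = A z \<and> \<phi> z \<le> r}"
  define T where "T = {(v, r). r < - g v}"
  have "convex S"
  proof (rule convexI)
    fix p q :: "'b \<times> real" and a b :: real
    assume p: "p \<in> S" and q: "q \<in> S" and ab: "0 \<le> a" "0 \<le> b" "a + b = 1"
    obtain z where z: "z \<in> C" "fst p = A z" "\<phi> z \<le> snd p" using p by (auto simp: S_def)
    obtain w where w: "w \<in> C" "fst q = A w" "\<phi> w \<le> snd q" using q by (auto simp: S_def)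
    have in_C: "a *\<^sub>R z + b *\<^sub>R w \<in> C"
      using convex_on_imp_convex[OF \<phi>] z(1) w(1) ab by (rule convexD)
    have "\<phi> (a *\<^sub>R z + b *\<^sub>R w) \<le> a * \<phi> z + b * \<phi> w"
      using \<phi> z(1) w(1) ab by (auto simp: convex_on_def)
    also have "\<dots> \<le> a * snd p + b * snd q"
      using z w ab by (intro add_mono mult_left_mono) auto
    finally show "a *\<^sub>R p + b *\<^sub>R q \<in> S"
      using in_C z(2) w(2) A
      by (auto simp: S_def split_beta linear_add linear_scale intro!: bexI[of _ "a *\<^sub>R z + b *\<^sub>R w"])
  qed
  moreover have "convex T"
  proof (rule convexI)
    fix p q :: "'b \<times> real" and a b :: real
    assume p: "p \<in> T" and q: "q \<in> T" and ab: "0 \<le> a" "0 \<le> b" "a + b = 1"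
    have less: "snd p < - g (fst p)" "snd q < - g (fst q)" using p q by (auto simp: T_def)
    have "a * snd p + b * snd q < a * (- g (fst p)) + b * (- g (fst q))"
    proof (cases "a = 0")
      case True
      then show ?thesis using ab less by simp
    next
      case False
      then have "a * snd p < a * (- g (fst p))" using ab less by (intro mult_strict_left_mono) auto
      moreover have "b * snd q \<le> b * (- g (fst q))" using ab less by (intro mult_left_mono) auto
      ultimately show ?thesis by linarith
    qed
    moreover have "g (a *\<^sub>R fst p + b *\<^sub>R fst q) \<le> a * g (fst p) + b * g (fst q)"
      using g ab by (auto simp: convex_on_def)
    ultimately show "a *\<^sub>R p + b *\<^sub>R q \<in> T"
      by (auto simp: T_def split_beta)
  qed
  moreover have "S \<noteq> {}" using \<open>C \<noteq> {}\<close> by (auto simp: S_def)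
  moreover have "(0, - g 0 - 1) \<in> T" by (simp add: T_def)
  then have "T \<noteq> {}" by blast
  moreover have "S \<inter> T = {}" using nonneg by (force simp: S_def T_def)
  ultimately obtain a b where ab: "a \<noteq> 0" "\<And>x. x \<in> S \<Longrightarrow> a \<bullet> x \<le> b" "\<And>x. x \<in> T \<Longrightarrow> b \<le> a \<bullet> x"
    using separating_hyperplane_sets[of S T] by blast
  obtain q t where a: "a = (q, t)" by fastforce
  have below: "b \<le> q \<bullet> v + t * r" if "r < - g v" for v r
    using ab(3)[of "(v, r)"] that by (simp add: a T_def)
  have above: "q \<bullet> A z + t * \<phi> z \<le> b" if "z \<in> C" for z
    using ab(2)[of "(A z, \<phi> z)"] that by (auto simp: a S_def)
  have "t \<le> 0"
  proof (rule ccontr)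
    assume "\<not> t \<le> 0"
    then have t: "t > 0" by simp
    define r where "r = min (- g 0 - 1) ((b - 1) / t)"
    have "t * r \<le> t * ((b - 1) / t)" unfolding r_def using t by (intro mult_left_mono) auto
    also have "\<dots> = b - 1" using t by simp
    finally have "t * r \<le> b - 1" .
    moreover have "r < - g 0" using min.cobounded1[of "- g 0 - 1" "(b - 1) / t"] by (simp add: r_def)
    ultimately show False using below[of r 0] by simp
  qed
  \<comment> \<open>A vertical hyperplane would bound a nonzero linear functional from below on the whole space,
      because \<open>T\<close> projects onto it.\<close>
  moreover have "t \<noteq> 0"
  proof
    assume t: "t = 0"
    then have "q \<noteq> 0" using ab(1) a by (simp add: zero_prod_def)
    have "b \<le> q \<bullet> (((b - 1) / (q \<bullet> q)) *\<^sub>R q)"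
      using below[of "- g (((b - 1) / (q \<bullet> q)) *\<^sub>R q) - 1" "((b - 1) / (q \<bullet> q)) *\<^sub>R q"] t by simp
    also have "\<dots> = b - 1" using \<open>q \<noteq> 0\<close> by simp
    finally show False by simp
  qed
  ultimately have t: "t < 0" by simp
  define \<tau> where "\<tau> = - t"
  have \<tau>: "\<tau> > 0" and t_eq: "t = - \<tau>" using t by (auto simp: \<tau>_def)
  have touch: "b \<le> q \<bullet> v + \<tau> * g v" for v
  proof (rule field_le_epsilon)
    fix e :: real assume "e > 0"
    then have "b \<le> q \<bullet> v + t * (- g v - e / \<tau>)" using \<tau> by (intro below) simp
    also have "\<dots> = q \<bullet> v + \<tau> * g v + e" using \<tau> by (simp add: t_eq algebra_simps)
    finally show "b \<le> q \<bullet> v + \<tau> * g v + e" .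
  qed
  show thesis
  proof (rule that[of "(- 1 / \<tau>) *\<^sub>R q" "b / \<tau>"])
    fix v
    show "(- 1 / \<tau>) *\<^sub>R q \<bullet> v + b / \<tau> \<le> g v"
      using touch[of v] \<tau> by (simp add: field_simps)
  next
    fix z assume "z \<in> C"
    then show "0 \<le> \<phi> z + (- 1 / \<tau>) *\<^sub>R q \<bullet> A z + b / \<tau>"
      using above[of z] \<tau> by (simp add: t_eq field_simps)
  qed
qed

section \<open>Minimizers over a convex set\<close>

lemma has_derivative_nonneg_at_minimizer:
  fixes \<psi> :: "'a::real_normed_vector \<Rightarrow> real"
  assumes "convex S" and "p \<in> S" and "z \<in> S" and D: "(\<psi> has_derivative D) (at p)"
    and min: "\<And>y. y \<in> S \<Longrightarrow> \<psi> p \<le> \<psi> y"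
  shows "0 \<le> D (z - p)"
proof (rule ccontr)
  assume neg: "\<not> 0 \<le> D (z - p)"
  have line: "((\<lambda>t::real. p + t *\<^sub>R (z - p)) has_derivative (\<lambda>t. t *\<^sub>R (z - p))) (at 0)"
    by (auto intro!: derivative_eq_intros)
  have "((\<lambda>t. \<psi> (p + t *\<^sub>R (z - p))) has_derivative (\<lambda>t. D (t *\<^sub>R (z - p)))) (at 0)"
    using has_derivative_compose[OF line, of \<psi> D] D by simp
  then have "((\<lambda>t. \<psi> (p + t *\<^sub>R (z - p))) has_real_derivative D (z - p)) (at 0)"
    using linear_scale[OF has_derivative_linear[OF D]]
    by (simp add: has_field_derivative_def mult.commute[of "D (z - p)"] mult_commute_abs)
  then obtain d where d: "d > 0" "\<And>h. 0 < h \<Longrightarrow> h < d \<Longrightarrow> \<psi> (p + h *\<^sub>R (z - p)) < \<psi> p"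
    using DERIV_neg_dec_right[of "\<lambda>t. \<psi> (p + t *\<^sub>R (z - p))" "D (z - p)" 0] neg by auto
  define h where "h = min (d / 2) 1"
  have h: "0 < h" "h < d" "h \<le> 1" using d(1) by (auto simp: h_def)
  have "(1 - h) *\<^sub>R p + h *\<^sub>R z \<in> S" using assms(1-3) h by (intro convexD_alt) auto
  then have "p + h *\<^sub>R (z - p) \<in> S" by (simp add: algebra_simps)
  then show False using min d(2)[OF h(1,2)] by fastforce
qed

text \<open>
  Moving from the minimizer \<open>v\<close> a fraction \<open>t\<close> of the way towards \<open>y\<close> does not decrease the objective,
  while strong convexity gains \<open>t (1 - t) L/2 \<parallel>y - v\<parallel>\<^sup>2\<close> over the chord; divide by \<open>t\<close> and let
  \<open>t\<close> tend to 0.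
\<close>

lemma quadratic_growth_at_prox_minimizer:
  fixes h :: "'a::real_inner \<Rightarrow> real"
  assumes h: "convex_on S h" and v: "v \<in> S" and y: "y \<in> S"
    and min: "\<And>z. z \<in> S \<Longrightarrow> h v + L / 2 * (norm (v - c))\<^sup>2 \<le> h z + L / 2 * (norm (z - c))\<^sup>2"
  shows "h v + L / 2 * (norm (v - c))\<^sup>2 + L / 2 * (norm (y - v))\<^sup>2 \<le> h y + L / 2 * (norm (y - c))\<^sup>2"
    (is "?Q v + ?b \<le> ?Q y")
proof -
  have le: "?Q v + ?b * (1 - t) \<le> ?Q y" if t: "0 < t" "t < 1" for t
  proof -
    define z where "z = (1 - t) *\<^sub>R v + t *\<^sub>R y"
    have z: "z \<in> S"
      unfolding z_def using convex_on_imp_convex[OF h] v y t by (intro convexD_alt) auto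
    have hz: "h z \<le> (1 - t) * h v + t * h y"
      using h v y t unfolding z_def convex_on_def by auto
    have nz: "(norm (z - c))\<^sup>2
        = (1 - t) * (norm (v - c))\<^sup>2 + t * (norm (y - c))\<^sup>2 - t * (1 - t) * (norm (y - v))\<^sup>2"
      by (simp add: z_def power2_norm_eq_inner inner_simps inner_commute algebra_simps)
    have "?Q v \<le> h z + L / 2 * (norm (z - c))\<^sup>2" by (rule min[OF z])
    also have "\<dots> \<le> (1 - t) * h v + t * h y + L / 2 * (norm (z - c))\<^sup>2" using hz by simp
    also have "\<dots> = (1 - t) * ?Q v + t * ?Q y - t * (?b * (1 - t))"
      by (simp add: nz field_simps)
    finally have "t * (?Q v + ?b * (1 - t)) \<le> t * ?Q y" by (simp add: field_simps)
    then show ?thesis using t by simp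
  qed
  have "((\<lambda>t. ?Q v + ?b * (1 - t)) \<longlongrightarrow> ?Q v + ?b * (1 - 0)) (at_right (0::real))"
    by (intro tendsto_intros)
  moreover have "\<forall>\<^sub>F t::real in at_right 0. ?Q v + ?b * (1 - t) \<le> ?Q y"
    using le unfolding eventually_at_right_field by (intro exI[of _ 1]) auto
  ultimately have "?Q v + ?b * (1 - 0) \<le> ?Q y"
    by (rule tendsto_upperbound) simp
  then show ?thesis by simp
qed

lemma arg_min_on_compact:
  fixes g :: "'a::topological_space \<Rightarrow> real"
  assumes "compact S" and "S \<noteq> {}" and "continuous_on S g"
  shows "arg_min_on g S \<in> S" and "\<And>y. y \<in> S \<Longrightarrow> g (arg_min_on g S) \<le> g y"
proof -
  obtain v where "v \<in> S" "\<And>y. y \<in> S \<Longrightarrow> g v \<le> g y"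
    using continuous_attains_inf[OF assms] by blast
  then have "is_arg_min g (\<lambda>y. y \<in> S) v" by (auto simp: is_arg_min_linorder)
  then have "is_arg_min g (\<lambda>y. y \<in> S) (arg_min_on g S)"
    unfolding arg_min_on_def arg_min_def by (rule someI)
  then show "arg_min_on g S \<in> S" "\<And>y. y \<in> S \<Longrightarrow> g (arg_min_on g S) \<le> g y"
    by (auto simp: is_arg_min_linorder)
qed

section \<open>Limit points of sequences\<close>

lemma limit_points_eq_Inter_closure_tails:
  "limit_points x = (\<Inter>n. closure (x ` {n..}))"
proof (intro equalityI subsetI)
  fix p assume "p \<in> limit_points x"
  then obtain r where r: "strict_mono r" "(x \<circ> r) \<longlonglongrightarrow> p" by (auto simp: limit_points_def)
  have "p \<in> closure (x ` {n..})" for n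
    unfolding closure_sequential
  proof (intro exI[of _ "\<lambda>j. (x \<circ> r) (j + n)"] conjI allI)
    fix j show "(x \<circ> r) (j + n) \<in> x ` {n..}"
      using seq_suble[OF r(1), of "j + n"] by auto
    show "(\<lambda>j. (x \<circ> r) (j + n)) \<longlonglongrightarrow> p" using r(2) by (rule LIMSEQ_ignore_initial_segment)
  qed
  then show "p \<in> (\<Inter>n. closure (x ` {n..}))" by blast
next
  fix p assume p: "p \<in> (\<Inter>n. closure (x ` {n..}))"
  have near: "\<exists>k\<ge>n. dist (x k) p < e" if "e > 0" for n e
  proof -
    have "p \<in> closure (x ` {n..})" using p by blast
    then show ?thesis using that by (auto simp: closure_approachable)
  qed
  have "\<exists>r. \<forall>j. dist (x (r j)) p < inverse (real (Suc j)) \<and> r j < r (Suc j)"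
  proof (rule dependent_nat_choice)
    show "\<exists>k. dist (x k) p < inverse (real (Suc 0))" using near[of 1 0] by auto
  next
    fix k j :: nat
    show "\<exists>k'. dist (x k') p < inverse (real (Suc (Suc j))) \<and> k < k'"
      using near[of "inverse (real (Suc (Suc j)))" "Suc k"] by (auto simp: Suc_le_eq)
  qed
  then obtain r where r: "\<And>j. dist (x (r j)) p < inverse (real (Suc j))" "\<And>j. r j < r (Suc j)"
    by blast
  have "(\<lambda>j. dist ((x \<circ> r) j) p) \<longlonglongrightarrow> 0"
    by (rule tendsto_sandwich[OF _ _ tendsto_const LIMSEQ_inverse_real_of_nat])
      (auto intro!: eventuallyI less_imp_le[OF r(1)] simp del: of_nat_Suc)
  then have "(x \<circ> r) \<longlonglongrightarrow> p" by (rule tendsto_dist_iff[THEN iffD2])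
  then show "p \<in> limit_points x" using r(2) by (auto simp: limit_points_def strict_mono_Suc_iff)
qed

text \<open>
  The indices of the subsequence can be chosen in any prescribed infinite set; this is how
  a property of the terms that recurs for ever is carried over to a limit point.
\<close>

lemma limit_point_along_infinite_set:
  assumes "compact C" and "range x \<subseteq> C" and "infinite N"
  obtains r p where "strict_mono r" and "\<And>j. r j \<in> N" and "(x \<circ> r) \<longlonglongrightarrow> p" and "p \<in> limit_points x"
proof -
  obtain q :: "nat \<Rightarrow> nat" where q: "strict_mono q" "\<And>j. q j \<in> N" using infinite_enumerate[OF assms(3)] by blast
  have "\<forall>j. (x \<circ> q) j \<in> C" using assms(2) by auto
  then obtain p s where s: "strict_mono s" "((x \<circ> q) \<circ> s) \<longlonglongrightarrow> p"
    using assms(1) by (meson compact_def)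
  have "strict_mono (q \<circ> s)" using q(1) s(1) by (rule strict_mono_o)
  moreover have "(x \<circ> (q \<circ> s)) \<longlonglongrightarrow> p" using s(2) by (simp add: comp_assoc)
  ultimately show thesis using q(2) by (intro that[of "q \<circ> s" p]) (auto simp: limit_points_def)
qed

text \<open>
  If the limit set split into closed pieces, separate the pieces by disjoint open sets \<open>U\<close> and \<open>V\<close>.
  Exits from \<open>U\<close> that happened infinitely often would accumulate at some limit point; since the
  steps vanish, both ends of those exits converge to it, and it lies neither in \<open>U\<close> nor in \<open>V\<close>.
  So from some index on \<open>U\<close> is never left, and the limit points in \<open>V\<close> cannot be reached.
\<close>

lemma connected_limit_points:
  assumes C: "compact C" and x: "range x \<subseteq> C"
    and steps: "(\<lambda>k. norm (x (Suc k) - x k)) \<longlonglongrightarrow> 0"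
  shows "connected (limit_points x)"
proof -
  have closed: "closed (limit_points x)" unfolding limit_points_eq_Inter_closure_tails by auto
  have False
    if AB: "closed A" "closed B" "A \<noteq> {}" "B \<noteq> {}" "A \<union> B = limit_points x" "A \<inter> B = {}" for A B
  proof -
    obtain U V where UV: "open U" "open V" "A \<subseteq> U" "B \<subseteq> V" "U \<inter> V = {}"
      using separation_normal[OF AB(1,2,6)] by blast
    have visit: "infinite {k. x k \<in> W}" if p: "p \<in> limit_points x" "p \<in> W" "open W" for p W
    proof
      assume fin: "finite {k. x k \<in> W}"
      obtain r where r: "strict_mono r" "(x \<circ> r) \<longlonglongrightarrow> p"
        using p(1) by (auto simp: limit_points_def)
      obtain j0 where "\<And>j. j \<ge> j0 \<Longrightarrow> (x \<circ> r) j \<in> W"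
        using topological_tendstoD[OF r(2) p(3,2)] by (auto simp: eventually_sequentially)
      then have "r ` {j0..} \<subseteq> {k. x k \<in> W}" by auto
      then have "finite (r ` {j0..})" using fin finite_subset by blast
      then have "finite {j0..}"
        using finite_imageD strict_mono_imp_inj_on[OF r(1)] inj_on_subset by blast
      then show False using infinite_Ici by blast
    qed
    have stay: "finite {k. x k \<in> U \<and> x (Suc k) \<notin> U}"
    proof (rule ccontr)
      assume "infinite {k. x k \<in> U \<and> x (Suc k) \<notin> U}"
      then obtain r p where r: "strict_mono r" "\<And>j. r j \<in> {k. x k \<in> U \<and> x (Suc k) \<notin> U}"
          "(x \<circ> r) \<longlonglongrightarrow> p" "p \<in> limit_points x"
        using limit_point_along_infinite_set[OF C x] by blast
      have "(\<lambda>j. x (Suc (r j)) - x (r j)) \<longlonglongrightarrow> 0"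
        using LIMSEQ_subseq_LIMSEQ[OF steps r(1)] tendsto_norm_zero_iff by (force simp: o_def)
      from tendsto_add[OF this r(3)] have r': "(\<lambda>j. x (Suc (r j))) \<longlonglongrightarrow> p" by simp
      have "p \<notin> U" using closed_sequentially[of "- U" "\<lambda>j. x (Suc (r j))" p] UV(1) r(2) r' by auto
      moreover have "p \<notin> V"
        using closed_sequentially[of "- V" "x \<circ> r" p] UV(2,5) r(2,3) by auto
      ultimately show False using r(4) AB(5) UV(3,4) by auto
    qed
    then obtain m where m: "\<And>k. k \<ge> m \<Longrightarrow> x k \<in> U \<Longrightarrow> x (Suc k) \<in> U"
      by (metis (mono_tags, lifting) finite_nat_set_iff_bounded mem_Collect_eq not_less)
    obtain a where "a \<in> A" using AB(3) by blast
    then have "infinite {k. x k \<in> U}" using visit[of a U] AB(5) UV(1,3) by blast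
    then obtain k where k: "k \<ge> m" "x k \<in> U"
      by (metis (mono_tags, lifting) infinite_nat_iff_unbounded_le mem_Collect_eq)
    have "x i \<in> U" if "i \<ge> k" for i
      using that by (induction rule: dec_induct) (use k m in auto)
    then have "{i. x i \<in> V} \<subseteq> {..<k}" using UV(5) by (force simp: not_le[symmetric])
    then have "finite {i. x i \<in> V}" using finite_subset by blast
    moreover obtain b where "b \<in> B" using AB(4) by blast
    ultimately show False using visit[of b V] AB(5) UV(2,4) by blast
  qed
  then show ?thesis unfolding connected_closed_set[OF closed] by metis
qed

lemma convergent_if_finite_limit_points:
  assumes C: "compact C" and x: "range x \<subseteq> C"
    and "connected (limit_points x)" and "finite (limit_points x)"
  obtains p where "x \<longlonglongrightarrow> p" and "p \<in> limit_points x"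
proof -
  have "infinite (UNIV :: nat set)" by simp
  then obtain p where p: "p \<in> limit_points x" using limit_point_along_infinite_set[OF C x] by metis
  have single: "limit_points x = {p}"
    using connected_finite_iff_sing[OF assms(3)] assms(4) p by auto
  have "x \<longlonglongrightarrow> p"
  proof (rule topological_tendstoI)
    fix W assume W: "open W" "p \<in> W"
    have "finite {k. x k \<notin> W}"
    proof (rule ccontr)
      assume "infinite {k. x k \<notin> W}"
      then obtain r q where r: "\<And>j. r j \<in> {k. x k \<notin> W}" "(x \<circ> r) \<longlonglongrightarrow> q" "q \<in> limit_points x"
        using limit_point_along_infinite_set[OF C x] by metis
      have "q \<notin> W" using closed_sequentially[of "- W" "x \<circ> r" q] W(1) r(1,2) by auto
      then show False using r(3) single W(2) by simp
    qed
    then show "\<forall>\<^sub>F k in sequentially. x k \<in> W"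
      by (simp add: eventually_cofinite flip: cofinite_eq_sequentially)
  qed
  then show thesis using p that by blast
qed

section \<open>Gradients, the l1-norm and convexity\<close>

lemma GDERIV_gradient:
  fixes f :: "real^'d \<Rightarrow> real"
  assumes "f differentiable (at x)"
  shows "GDERIV f x :> gradient f x"
proof -
  obtain D where D: "(f has_derivative D) (at x)" using assms by (auto simp: differentiable_def)
  have lin: "linear D" using D by (rule has_derivative_linear)
  \<comment> \<open>The vector that represents the functional \<open>D\<close> is the image of 1 under the adjoint map.\<close>
  have "D h = h \<bullet> adjoint D 1" for h using adjoint_works[OF lin, of h 1] by simp
  then have "D = (\<lambda>h. h \<bullet> adjoint D 1)" by blast
  then have ex: "GDERIV f x :> adjoint D 1" using D by (metis gderiv_def)
  have "E = adjoint D 1" if "GDERIV f x :> E" for E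
  proof -
    have "(\<lambda>h. h \<bullet> E) = (\<lambda>h. h \<bullet> adjoint D 1)"
      using that ex unfolding gderiv_def by (rule has_derivative_unique)
    then have "\<forall>h. h \<bullet> E = h \<bullet> adjoint D 1" by metis
    then show ?thesis by (simp only: vector_eq_ldot)
  qed
  with ex show ?thesis unfolding gradient_def by (rule theI)
qed

lemma convex_on_l1_norm: "convex_on UNIV (l1_norm :: real^'n \<Rightarrow> real)"
proof (rule convex_onI)
  fix t :: real and a b :: "real^'n"
  assume t: "0 < t" "t < 1"
  have "\<bar>(1 - t) * (a $ i) + t * (b $ i)\<bar> \<le> (1 - t) * \<bar>a $ i\<bar> + t * \<bar>b $ i\<bar>" for i
    using abs_triangle_ineq[of "(1 - t) * (a $ i)" "t * (b $ i)"] t by (simp add: abs_mult)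
  then show "l1_norm ((1 - t) *\<^sub>R a + t *\<^sub>R b) \<le> (1 - t) * l1_norm a + t * l1_norm b"
    by (auto simp: l1_norm_def sum_distrib_left sum.distrib[symmetric] intro!: sum_mono)
qed simp

lemma continuous_on_l1_norm [continuous_intros]:
  "continuous_on S g \<Longrightarrow> continuous_on S (\<lambda>x. l1_norm (g x))"
  unfolding l1_norm_def by (intro continuous_intros)

lemma tendsto_l1_norm [tendsto_intros]:
  "(g \<longlongrightarrow> a) F \<Longrightarrow> ((\<lambda>x. l1_norm (g x)) \<longlongrightarrow> l1_norm a) F"
  unfolding l1_norm_def by (intro tendsto_intros)

lemma convex_on_affine_compose:
  assumes g: "convex_on UNIV g" and A: "linear A" and "convex S"
  shows "convex_on S (\<lambda>z. g (a + A (z - c)))"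
proof (rule convex_onI)
  fix t :: real and y z
  assume t: "0 < t" "t < 1"
  have "a + A ((1 - t) *\<^sub>R y + t *\<^sub>R z - c) = (1 - t) *\<^sub>R (a + A (y - c)) + t *\<^sub>R (a + A (z - c))"
    by (simp add: linear_add[OF A] linear_diff[OF A] linear_scale[OF A] algebra_simps)
  then show "g (a + A ((1 - t) *\<^sub>R y + t *\<^sub>R z - c)) \<le> (1 - t) * g (a + A (y - c)) + t * g (a + A (z - c))"
    using convex_onD[OF g, of t] t by simp
qed fact

lemma convex_on_norm_diff_sq:
  fixes c :: "'a::real_inner"
  assumes "convex S"
  shows "convex_on S (\<lambda>z. (norm (z - c))\<^sup>2)"
proof (rule convex_onI)
  fix t :: real and y z
  assume t: "0 < t" "t < 1"
  have "(norm ((1 - t) *\<^sub>R y + t *\<^sub>R z - c))\<^sup>2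
      = (1 - t) * (norm (y - c))\<^sup>2 + t * (norm (z - c))\<^sup>2 - t * (1 - t) * (norm (z - y))\<^sup>2"
    by (simp add: power2_norm_eq_inner inner_simps inner_commute algebra_simps)
  then show "(norm ((1 - t) *\<^sub>R y + t *\<^sub>R z - c))\<^sup>2 \<le> (1 - t) * (norm (y - c))\<^sup>2 + t * (norm (z - c))\<^sup>2"
    using t by (simp add: mult_nonneg_nonneg)
qed fact

section \<open>The Gauss-Newton step\<close>

locale penalized_problem =
  fixes \<Omega> :: "(real^'d) set" and f :: "real^'d \<Rightarrow> real" and \<Psi> :: "real^'d \<Rightarrow> real^'n"
    and M \<beta> :: real
  assumes nonempty: "\<Omega> \<noteq> {}" and compact: "compact \<Omega>" and convex: "convex \<Omega>"
    and convex_f: "convex_on UNIV f" and differentiable_f: "\<And>x. f differentiable (at x)"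
    and differentiable_\<Psi>: "\<And>x. \<Psi> differentiable (at x)"
    and lipschitz: "jacobian_lipschitz_on M \<Omega> \<Psi>" and \<beta>_pos: "0 < \<beta>"
begin

abbreviation "J x \<equiv> jacobian \<Psi> (at x)"
abbreviation "F \<equiv> penalized f \<Psi> \<beta>"
abbreviation "Q \<equiv> gn_model f \<Psi> \<beta>"
abbreviation "V \<equiv> gn_step f \<Psi> \<Omega> \<beta>"

lemma continuous_f: "continuous_on S f"
  by (meson continuous_at_imp_continuous_on differentiable_f differentiable_imp_continuous_within)

lemma continuous_\<Psi>: "continuous_on S \<Psi>"
  by (meson continuous_at_imp_continuous_on differentiable_\<Psi> differentiable_imp_continuous_within)

lemma bdd_below_F: "bdd_below (F ` \<Omega>)"
proof -
  have "continuous_on \<Omega> F"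
    unfolding penalized_def by (intro continuous_intros continuous_f continuous_\<Psi>)
  then have "compact (F ` \<Omega>)" using compact by (rule compact_continuous_image)
  then show ?thesis by (simp add: compact_imp_bounded bounded_imp_bdd_below)
qed

lemma gn_step_minimizes:
  shows gn_step_in: "V L c \<in> \<Omega>" and gn_step_le: "\<And>y. y \<in> \<Omega> \<Longrightarrow> Q L c (V L c) \<le> Q L c y"
proof -
  have "continuous_on \<Omega> (Q L c)"
    unfolding gn_model_def
    by (intro continuous_intros continuous_f bounded_linear.continuous_on[OF matrix_vector_mul_bounded_linear])
  from arg_min_on_compact[OF compact nonempty this]
  show "V L c \<in> \<Omega>" "\<And>y. y \<in> \<Omega> \<Longrightarrow> Q L c (V L c) \<le> Q L c y" by (auto simp: gn_step_def)
qed

lemma gn_step_growth: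
  assumes "y \<in> \<Omega>"
  shows "Q L c (V L c) + L / 2 * (norm (y - V L c))\<^sup>2 \<le> Q L c y"
proof -
  have "convex_on \<Omega> (\<lambda>z. f z + \<beta> * l1_norm (\<Psi> c + J c *v (z - c)))"
    using \<beta>_pos convex convex_on_subset[OF convex_f]
    by (intro convex_on_add convex_on_cmul convex_on_affine_compose convex_on_l1_norm
        matrix_vector_mul_linear) auto
  from quadratic_growth_at_prox_minimizer[OF this gn_step_in assms, of L c L c]
  show ?thesis using gn_step_le[of _ L c] by (simp add: gn_model_def)
qed

lemma gn_model_at_center: "Q L c c = F c"
  by (simp add: gn_model_def penalized_def)

lemma sufficient_decrease:
  assumes "c \<in> \<Omega>" and "F (V L c) \<le> Q L c (V L c)"
  shows "L / 2 * (norm (V L c - c))\<^sup>2 \<le> F c - F (V L c)"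
  using gn_step_growth[OF assms(1), of L c] assms(2)
  by (simp add: gn_model_at_center norm_minus_commute)

text \<open>
  Add the two inequalities that say that each step minimizes its own model: everything but the
  quadratic terms cancels.
\<close>

lemma step_length_antimono:
  assumes "L \<le> L'"
  shows "norm (V L' c - c) \<le> norm (V L c - c)"
proof (cases "L = L'")
  case False
  have "Q L c (V L c) \<le> Q L c (V L' c)" and "Q L' c (V L' c) \<le> Q L' c (V L c)"
    by (auto intro: gn_step_le gn_step_in)
  then have "(L' - L) * (norm (V L' c - c))\<^sup>2 \<le> (L' - L) * (norm (V L c - c))\<^sup>2"
    unfolding gn_model_def by (simp add: algebra_simps)
  then show ?thesis using assms False by (simp add: power2_le_iff_abs_le)
qed simp

section \<open>Stationarity of fixed points of the step\<close>

text \<open>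
  The nonsmooth term of the model depends on \<open>z\<close> only through \<open>J p *v z\<close>, so the sandwich lemma
  replaces it by an affine function and produces the subgradient at the same time.  Minimality of \<open>p\<close>
  then concerns a differentiable function, and the quadratic term has derivative 0 at \<open>p\<close>.
\<close>

lemma stationary_if_model_minimizer:
  assumes p: "p \<in> \<Omega>" and min: "\<And>z. z \<in> \<Omega> \<Longrightarrow> F p \<le> Q L p z" and L: "0 \<le> L"
  shows "stationary_P f \<Psi> \<Omega> \<beta> p"
proof -
  define A where "A = (\<lambda>v. J p *v v)"
  have A: "linear A" by (simp add: A_def)
  \<comment> \<open>Subtracting \<open>F p\<close> from the smooth part makes the sum of the two functions vanish at \<open>p\<close>, which
      forces the affine minorant to touch \<open>g\<close> at \<open>A p\<close>.\<close>
  define \<phi> where "\<phi> = (\<lambda>z. f z + L / 2 * (norm (z - p))\<^sup>2 + - F p)"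
  define g where "g = (\<lambda>v. \<beta> * l1_norm ((\<Psi> p - A p) + v))"
  have "convex_on \<Omega> \<phi>"
    unfolding \<phi>_def using L convex convex_on_subset[OF convex_f]
    by (intro convex_on_add convex_on_cmul convex_on_norm_diff_sq) (auto simp: convex_on_const)
  moreover have "convex_on UNIV g"
    unfolding g_def using \<beta>_pos
      convex_on_affine_compose[OF convex_on_l1_norm linear_id, of UNIV "\<Psi> p - A p" 0]
    by (intro convex_on_cmul) (auto simp: id_def)
  moreover have "0 \<le> \<phi> z + g (A z)" if "z \<in> \<Omega>" for z
    using min[OF that] by (simp add: \<phi>_def g_def A_def gn_model_def algebra_simps)
  ultimately obtain s c where s: "\<And>v. s \<bullet> v + c \<le> g v"
      and nonneg: "\<And>z. z \<in> \<Omega> \<Longrightarrow> 0 \<le> \<phi> z + s \<bullet> A z + c"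
    using convex_sandwich_linear[OF nonempty _ _ A] by metis
  have "0 \<le> - (\<beta> * l1_norm (\<Psi> p)) + s \<bullet> A p + c" using nonneg[OF p] by (simp add: \<phi>_def penalized_def)
  moreover have "s \<bullet> A p + c \<le> \<beta> * l1_norm (\<Psi> p)" using s[of "A p"] by (simp add: g_def)
  ultimately have tight: "s \<bullet> A p + c = \<beta> * l1_norm (\<Psi> p)" by simp
  define \<sigma> where "\<sigma> = (1 / \<beta>) *\<^sub>R s"
  have s_eq: "s = \<beta> *\<^sub>R \<sigma>" using \<beta>_pos by (simp add: \<sigma>_def)
  have "\<sigma> \<in> subdifferential l1_norm (\<Psi> p)"
    unfolding subdifferential_def
  proof (intro CollectI allI)
    fix v
    have "s \<bullet> (v - \<Psi> p + A p) + c \<le> \<beta> * l1_norm v" using s[of "v - \<Psi> p + A p"] by (simp add: g_def)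
    then have "\<beta> * (l1_norm (\<Psi> p) + \<sigma> \<bullet> (v - \<Psi> p)) \<le> \<beta> * l1_norm v"
      using tight by (simp add: s_eq inner_simps algebra_simps)
    then show "l1_norm (\<Psi> p) + \<sigma> \<bullet> (v - \<Psi> p) \<le> l1_norm v" using \<beta>_pos by simp
  qed
  moreover define w where "w = - (gradient f p + \<beta> *\<^sub>R (transpose (J p) *v \<sigma>))"
  have "w \<in> normal_cone \<Omega> p"
  proof -
    define \<psi> where "\<psi> = (\<lambda>z. f z + L / 2 * ((z - p) \<bullet> (z - p)) + s \<bullet> A z)"
    have df: "(f has_derivative (\<lambda>h. h \<bullet> gradient f p)) (at p)"
      using GDERIV_gradient[OF differentiable_f] by (simp add: gderiv_def)
    have dA: "(A has_derivative A) (at p)"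
      unfolding A_def by (rule bounded_linear_imp_has_derivative) simp
    have D: "(\<psi> has_derivative (\<lambda>h. h \<bullet> gradient f p + s \<bullet> A h)) (at p)"
      unfolding \<psi>_def by (auto intro!: derivative_eq_intros df dA)
    have "\<psi> p \<le> \<psi> z" if "z \<in> \<Omega>" for z
      using nonneg[OF that] tight
      by (simp add: \<phi>_def \<psi>_def penalized_def power2_norm_eq_inner)
    then have "0 \<le> (z - p) \<bullet> gradient f p + s \<bullet> A (z - p)" if "z \<in> \<Omega>" for z
      using has_derivative_nonneg_at_minimizer[OF convex p that D] by blast
    moreover have "w \<bullet> h = - (h \<bullet> gradient f p + s \<bullet> A h)" for h
      by (simp add: w_def s_eq A_def inner_simps transpose_matrix_vector dot_lmul_matrix
          inner_commute[of h])
    ultimately have "w \<bullet> (z - p) \<le> 0" if "z \<in> \<Omega>" for z using that by fastforce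
    then show ?thesis using p by (simp add: normal_cone_def)
  qed
  ultimately show ?thesis
    unfolding stationary_P_def using p
    by (intro conjI CollectI exI[of _ \<sigma>] exI[of _ w]) (auto simp: w_def)
qed

end

section \<open>Runs of the algorithm\<close>

locale gauss_newton_run = penalized_problem \<Omega> f \<Psi> M \<beta>
    for \<Omega> :: "(real^'d) set" and f and \<Psi> :: "real^'d \<Rightarrow> real^'n" and M \<beta> +
  fixes Lmin :: real and L :: "nat \<Rightarrow> real" and x :: "nat \<Rightarrow> real^'d"
  assumes run: "basic_gauss_newton f \<Psi> \<Omega> M \<beta> Lmin L x"
begin

lemma Lmin: "0 < Lmin" "Lmin \<le> L k" "L k \<le> \<beta> * M" "Lmin \<le> \<beta> * M"
  using run by (auto simp: basic_gauss_newton_def)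

lemma x_Suc: "x (Suc k) = V (L k) (x k)"
  using run by (auto simp: basic_gauss_newton_def)

lemma x_in: "x k \<in> \<Omega>"
  using run by (cases k) (auto simp: basic_gauss_newton_def gn_step_in)

lemma decrease: "L k / 2 * (norm (x (Suc k) - x k))\<^sup>2 \<le> F (x k) - F (x (Suc k))"
  using run sufficient_decrease[OF x_in, of "L k" k] by (simp add: x_Suc basic_gauss_newton_def)

lemma decrease_Lmin: "Lmin / 2 * (norm (x (Suc k) - x k))\<^sup>2 \<le> F (x k) - F (x (Suc k))"
proof -
  have "Lmin / 2 * (norm (x (Suc k) - x k))\<^sup>2 \<le> L k / 2 * (norm (x (Suc k) - x k))\<^sup>2"
    using Lmin(2) by (intro mult_right_mono) auto
  then show ?thesis using decrease[of k] by linarith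
qed

lemma decseq_F: "decseq (\<lambda>k. F (x k))"
proof (rule decseq_SucI)
  fix k
  have "0 \<le> Lmin / 2 * (norm (x (Suc k) - x k))\<^sup>2" using Lmin(1) by simp
  then show "F (x (Suc k)) \<le> F (x k)" using decrease_Lmin[of k] by linarith
qed

lemma sum_steps: "Lmin / 2 * (\<Sum>k<m. (norm (x (Suc k) - x k))\<^sup>2) \<le> F (x 0) - (INF z\<in>\<Omega>. F z)"
proof -
  have "Lmin / 2 * (\<Sum>k<m. (norm (x (Suc k) - x k))\<^sup>2) \<le> (\<Sum>k<m. F (x k) - F (x (Suc k)))"
    unfolding sum_distrib_left by (intro sum_mono decrease_Lmin)
  also have "\<dots> = F (x 0) - F (x m)" by (induction m) auto
  also have "\<dots> \<le> F (x 0) - (INF z\<in>\<Omega>. F z)" using cINF_lower[OF bdd_below_F x_in] by simp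
  finally show ?thesis .
qed

lemma steps_tendsto_zero: "(\<lambda>k. norm (x (Suc k) - x k)) \<longlonglongrightarrow> 0"
proof -
  have "summable (\<lambda>k. (norm (x (Suc k) - x k))\<^sup>2)"
  proof (rule summableI_nonneg_bounded)
    fix m
    show "(\<Sum>k<m. (norm (x (Suc k) - x k))\<^sup>2) \<le> (F (x 0) - (INF z\<in>\<Omega>. F z)) * 2 / Lmin"
      using sum_steps[of m] Lmin(1) by (simp add: field_simps)
  qed simp
  then have "(\<lambda>k. (norm (x (Suc k) - x k))\<^sup>2) \<longlonglongrightarrow> 0" by (rule summable_LIMSEQ_zero)
  from tendsto_real_sqrt[OF this] show ?thesis by simp
qed

abbreviation "G k \<equiv> norm (gn_gradient_map f \<Psi> \<Omega> \<beta> (\<beta> * M) (x k))"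

lemma gradient_map_le: "G k \<le> \<beta> * M * norm (x (Suc k) - x k)"
proof -
  have "0 \<le> \<beta> * M" using Lmin(1,4) by linarith
  then have "G k = \<beta> * M * norm (V (\<beta> * M) (x k) - x k)"
    by (simp add: gn_gradient_map_def norm_minus_commute)
  also have "\<dots> \<le> \<beta> * M * norm (x (Suc k) - x k)"
    unfolding x_Suc by (intro mult_left_mono step_length_antimono Lmin(3)) fact
  finally show ?thesis .
qed

lemma gradient_map_tendsto_zero: "G \<longlonglongrightarrow> 0"
proof (rule tendsto_sandwich[OF _ _ tendsto_const])
  show "(\<lambda>k. \<beta> * M * norm (x (Suc k) - x k)) \<longlonglongrightarrow> 0"
    using tendsto_mult_right_zero[OF steps_tendsto_zero] by simp
qed (auto intro!: eventuallyI gradient_map_le)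

lemma Min_gradient_map_le:
  "Min ((\<lambda>k. (G k)\<^sup>2) ` {0..K})
    \<le> 2 * (\<beta> * M)\<^sup>2 / (Lmin * (real K + 1)) * (F (x 0) - (INF z\<in>\<Omega>. F z))"
proof -
  let ?m = "Min ((\<lambda>k. (G k)\<^sup>2) ` {0..K})"
  let ?S = "\<Sum>k<Suc K. (norm (x (Suc k) - x k))\<^sup>2"
  have "?m \<le> (\<beta> * M)\<^sup>2 * (norm (x (Suc k) - x k))\<^sup>2" if "k < Suc K" for k
  proof -
    have "?m \<le> (G k)\<^sup>2" using that by (intro Min_le) auto
    also have "\<dots> \<le> (\<beta> * M * norm (x (Suc k) - x k))\<^sup>2"
      by (intro power_mono gradient_map_le) simp
    finally show ?thesis by (simp add: power_mult_distrib)
  qed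
  then have "(\<Sum>k<Suc K. ?m) \<le> (\<Sum>k<Suc K. (\<beta> * M)\<^sup>2 * (norm (x (Suc k) - x k))\<^sup>2)"
    by (intro sum_mono) auto
  then have "(real K + 1) * ?m \<le> (\<beta> * M)\<^sup>2 * ?S"
    by (simp add: sum_distrib_left distrib_left add.commute)
  also have "\<dots> \<le> (\<beta> * M)\<^sup>2 * (2 / Lmin * (F (x 0) - (INF z\<in>\<Omega>. F z)))"
    using sum_steps[of "Suc K"] Lmin(1) by (intro mult_left_mono) (simp_all add: field_simps)
  finally have "?m \<le> (\<beta> * M)\<^sup>2 * (2 / Lmin * (F (x 0) - (INF z\<in>\<Omega>. F z))) / (real K + 1)"
    by (subst pos_le_divide_eq) (simp_all add: mult.commute)
  also have "\<dots> = 2 * (\<beta> * M)\<^sup>2 / (Lmin * (real K + 1)) * (F (x 0) - (INF z\<in>\<Omega>. F z))"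
    by (simp only: times_divide_eq_left times_divide_eq_right divide_divide_eq_left ac_simps)
  finally show ?thesis .
qed

lemma tendsto_jacobian_mult:
  assumes "\<And>j. u j \<in> \<Omega>" and "p \<in> \<Omega>" and u: "u \<longlonglongrightarrow> p" and w: "w \<longlonglongrightarrow> w'"
  shows "(\<lambda>j. J (u j) *v w j) \<longlonglongrightarrow> J p *v w'"
proof -
  have "(\<lambda>j. (J (u j) - J p) *v w j) \<longlonglongrightarrow> 0"
  proof (rule Lim_null_comparison)
    have "norm ((J (u j) - J p) *v w j) \<le> M * norm (u j - p) * norm (w j)" for j
    proof -
      have "norm ((J (u j) - J p) *v w j) \<le> onorm ((*v) (J (u j) - J p)) * norm (w j)"
        by (rule onorm[OF matrix_vector_mul_bounded_linear])
      also have "\<dots> \<le> M * norm (u j - p) * norm (w j)"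
        using lipschitz assms(1,2) by (intro mult_right_mono) (auto simp: jacobian_lipschitz_on_def)
      finally show ?thesis .
    qed
    then show "\<forall>\<^sub>F j in sequentially. norm ((J (u j) - J p) *v w j) \<le> M * norm (u j - p) * norm (w j)"
      by simp
    have "(\<lambda>j. M * norm (u j - p) * norm (w j)) \<longlonglongrightarrow> M * norm (p - p) * norm w'"
      by (intro tendsto_intros u w)
    then show "(\<lambda>j. M * norm (u j - p) * norm (w j)) \<longlonglongrightarrow> 0" by simp
  qed
  moreover have "(\<lambda>j. J p *v w j) \<longlonglongrightarrow> J p *v w'"
    by (intro bounded_linear.tendsto[OF matrix_vector_mul_bounded_linear] w)
  ultimately have "(\<lambda>j. (J (u j) - J p) *v w j + J p *v w j) \<longlonglongrightarrow> 0 + J p *v w'"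
    by (rule tendsto_add)
  then show ?thesis by (simp add: matrix_vector_mult_diff_rdistrib)
qed

lemma limit_point_stationary:
  assumes "p \<in> limit_points x"
  shows "stationary_P f \<Psi> \<Omega> \<beta> p"
proof -
  obtain r where r: "strict_mono r" "(x \<circ> r) \<longlonglongrightarrow> p" using assms by (auto simp: limit_points_def)
  define u where "u = x \<circ> r"
  define w where "w = (\<lambda>j. x (Suc (r j)) - x (r j))"
  have u: "u \<longlonglongrightarrow> p" using r(2) by (simp add: u_def)
  have u_in: "u j \<in> \<Omega>" for j by (simp add: u_def x_in)
  have p: "p \<in> \<Omega>" using closed_sequentially[OF compact_imp_closed[OF compact]] u u_in by blast
  have w: "w \<longlonglongrightarrow> 0"
    using LIMSEQ_subseq_LIMSEQ[OF steps_tendsto_zero r(1)] tendsto_norm_zero_iff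
    by (force simp: o_def w_def)
  have next_step: "(\<lambda>j. u j + w j) \<longlonglongrightarrow> p" using tendsto_add[OF u w] by simp
  have f_lim: "(\<lambda>j. f (v j)) \<longlonglongrightarrow> f p" if "v \<longlonglongrightarrow> p" for v
    using continuous_on_tendsto_compose[OF continuous_f[of UNIV] that] by simp
  have \<Psi>_lim: "(\<lambda>j. \<Psi> (u j)) \<longlonglongrightarrow> \<Psi> p"
    using continuous_on_tendsto_compose[OF continuous_\<Psi>[of UNIV] u] by simp
  \<comment> \<open>Dropping the quadratic term on the left and enlarging \<open>L (r j)\<close> to \<open>\<beta> * M\<close> on the right leaves an
      inequality free of the step parameters, which need not converge.\<close>
  have "F p \<le> Q (\<beta> * M) p z" if z: "z \<in> \<Omega>" for z
  proof -
    have "f (u j + w j) + \<beta> * l1_norm (\<Psi> (u j) + J (u j) *v w j)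
        \<le> f z + \<beta> * l1_norm (\<Psi> (u j) + J (u j) *v (z - u j)) + \<beta> * M / 2 * (norm (z - u j))\<^sup>2" for j
    proof -
      have "Q (L (r j)) (u j) (u j + w j) \<le> Q (L (r j)) (u j) z"
        using gn_step_le[OF z, of "L (r j)" "x (r j)"] by (simp add: u_def w_def x_Suc)
      moreover have "L (r j) / 2 * (norm (z - u j))\<^sup>2 \<le> \<beta> * M / 2 * (norm (z - u j))\<^sup>2"
        using Lmin(3) by (intro mult_right_mono divide_right_mono) auto
      moreover have "0 < L (r j)" using Lmin(1) Lmin(2)[of "r j"] by linarith
      then have "0 \<le> L (r j) / 2 * (norm (w j))\<^sup>2" by simp
      ultimately show ?thesis by (simp add: gn_model_def)
    qed
    moreover have "(\<lambda>j. f (u j + w j) + \<beta> * l1_norm (\<Psi> (u j) + J (u j) *v w j))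
        \<longlonglongrightarrow> f p + \<beta> * l1_norm (\<Psi> p + J p *v 0)"
      by (intro tendsto_intros f_lim next_step \<Psi>_lim tendsto_jacobian_mult u_in p u w)
    moreover have "(\<lambda>j. f z + \<beta> * l1_norm (\<Psi> (u j) + J (u j) *v (z - u j)) + \<beta> * M / 2 * (norm (z - u j))\<^sup>2)
        \<longlonglongrightarrow> f z + \<beta> * l1_norm (\<Psi> p + J p *v (z - p)) + \<beta> * M / 2 * (norm (z - p))\<^sup>2"
      by (intro tendsto_intros \<Psi>_lim tendsto_jacobian_mult u_in p u)
    ultimately have "f p + \<beta> * l1_norm (\<Psi> p + J p *v 0)
        \<le> f z + \<beta> * l1_norm (\<Psi> p + J p *v (z - p)) + \<beta> * M / 2 * (norm (z - p))\<^sup>2"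
      by (intro LIMSEQ_le) auto
    then show ?thesis by (simp add: penalized_def gn_model_def)
  qed
  moreover have "0 \<le> \<beta> * M" using Lmin(1,4) by linarith
  ultimately show ?thesis using p by (intro stationary_if_model_minimizer)
qed

end

lemma stationary_C_if_feasible_stationary_P:
  assumes "stationary_P f \<Psi> \<Omega> \<beta> p" and "feasible_C \<Psi> \<Omega> p"
  shows "stationary_C f \<Psi> \<Omega> p"
proof -
  obtain s w where w: "w \<in> normal_cone \<Omega> p"
      and "0 = gradient f p + \<beta> *\<^sub>R (transpose (jacobian \<Psi> (at p)) *v s) + w"
    using assms(1) unfolding stationary_P_def by blast
  then have "w = - gradient f p - transpose (jacobian \<Psi> (at p)) *v (\<beta> *\<^sub>R s)"
    by (simp add: matrix_vector_mult_scaleR eq_neg_iff_add_eq_0 algebra_simps)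
  then show ?thesis using w assms(2) unfolding stationary_C_def feasible_C_def by blast
qed

theorem theorem2p1:
  fixes \<Omega> :: "(real^'d) set"
    and f :: "real^'d \<Rightarrow> real"
    and \<Psi> :: "real^'d \<Rightarrow> real^'n"
  assumes "\<Omega> \<noteq> {}" and "compact \<Omega>" and "convex \<Omega>"
    and "convex_on UNIV f" and "\<And>x. f differentiable (at x)"
    and "\<And>x. \<Psi> differentiable (at x)"
  shows "\<exists>\<beta>bar::real. \<forall>L\<^sub>\<Psi> \<beta> Lmin L x.
    jacobian_lipschitz_on L\<^sub>\<Psi> \<Omega> \<Psi> \<longrightarrow> basic_gauss_newton f \<Psi> \<Omega> L\<^sub>\<Psi> \<beta> Lmin L x \<longrightarrow>
      range x \<subseteq> level_set (penalized f \<Psi> \<beta>) \<Omega> (penalized f \<Psi> \<beta> (x 0)) \<and>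
      bdd_below (penalized f \<Psi> \<beta> ` \<Omega>) \<and>
      (\<forall>K::nat.
         Min ((\<lambda>k. (norm (gn_gradient_map f \<Psi> \<Omega> \<beta> (\<beta> * L\<^sub>\<Psi>) (x k)))\<^sup>2) ` {0..K})
           \<le> 2 * (\<beta> * L\<^sub>\<Psi>)\<^sup>2 / (Lmin * (real K + 1))
               * (penalized f \<Psi> \<beta> (x 0) - (INF z\<in>\<Omega>. penalized f \<Psi> \<beta> z))) \<and>
      (\<lambda>k. norm (x (k + 1) - x k)) \<longlonglongrightarrow> 0 \<and>
      (\<lambda>k. norm (gn_gradient_map f \<Psi> \<Omega> \<beta> (\<beta> * L\<^sub>\<Psi>) (x k))) \<longlonglongrightarrow> 0 \<and>
      connected (limit_points x) \<and>
      (bounded (level_set (penalized f \<Psi> \<beta>) \<Omega> (penalized f \<Psi> \<beta> (x 0))) \<longrightarrow> bounded (range x)) \<and>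
      (bounded (range x) \<longrightarrow> (\<forall>p\<in>limit_points x. stationary_P f \<Psi> \<Omega> \<beta> p)) \<and>
      (finite (limit_points x) \<longrightarrow>
         (\<exists>p. x \<longlonglongrightarrow> p \<and> stationary_P f \<Psi> \<Omega> \<beta> p \<and>
              (feasible_C \<Psi> \<Omega> p \<and> \<beta> \<ge> \<beta>bar \<longrightarrow> stationary_C f \<Psi> \<Omega> p)))"
proof (intro exI[of _ 0] allI impI)
  fix M \<beta> Lmin L x
  assume M: "jacobian_lipschitz_on M \<Omega> \<Psi>" and run: "basic_gauss_newton f \<Psi> \<Omega> M \<beta> Lmin L x"
  interpret gauss_newton_run \<Omega> f \<Psi> M \<beta> Lmin L x
    using assms M run by unfold_locales (auto simp: basic_gauss_newton_def)
  have in_\<Omega>: "range x \<subseteq> \<Omega>" using x_in by auto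
  have level: "range x \<subseteq> level_set F \<Omega> (F (x 0))"
    using x_in decseqD[OF decseq_F, of 0] by (auto simp: level_set_def)
  have connected: "connected (limit_points x)"
    using connected_limit_points[OF compact in_\<Omega> steps_tendsto_zero] .
  have finite_case: "\<exists>p. x \<longlonglongrightarrow> p \<and> stationary_P f \<Psi> \<Omega> \<beta> p \<and>
      (feasible_C \<Psi> \<Omega> p \<and> \<beta> \<ge> 0 \<longrightarrow> stationary_C f \<Psi> \<Omega> p)" if fin: "finite (limit_points x)"
    using convergent_if_finite_limit_points[OF compact in_\<Omega> connected fin]
    by (metis limit_point_stationary stationary_C_if_feasible_stationary_P)
  show "range x \<subseteq> level_set F \<Omega> (F (x 0)) \<and>
      bdd_below (F ` \<Omega>) \<and>
      (\<forall>K::nat. Min ((\<lambda>k. (G k)\<^sup>2) ` {0..K})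
           \<le> 2 * (\<beta> * M)\<^sup>2 / (Lmin * (real K + 1)) * (F (x 0) - (INF z\<in>\<Omega>. F z))) \<and>
      (\<lambda>k. norm (x (k + 1) - x k)) \<longlonglongrightarrow> 0 \<and>
      G \<longlonglongrightarrow> 0 \<and>
      connected (limit_points x) \<and>
      (bounded (level_set F \<Omega> (F (x 0))) \<longrightarrow> bounded (range x)) \<and>
      (bounded (range x) \<longrightarrow> (\<forall>p\<in>limit_points x. stationary_P f \<Psi> \<Omega> \<beta> p)) \<and>
      (finite (limit_points x) \<longrightarrow>
         (\<exists>p. x \<longlonglongrightarrow> p \<and> stationary_P f \<Psi> \<Omega> \<beta> p \<and>
              (feasible_C \<Psi> \<Omega> p \<and> \<beta> \<ge> 0 \<longrightarrow> stationary_C f \<Psi> \<Omega> p)))"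
    using level bdd_below_F Min_gradient_map_le steps_tendsto_zero gradient_map_tendsto_zero connected
      bounded_subset[OF _ level] limit_point_stationary finite_case
    by simp
qed

end
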